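(* Let $\mathcal{Z}\subseteq\mathbb{R}^n$ be a closed convex set and $F:\mathcal{Z}\to\mathbb{R}^n$ be a monotone and $L$-Lipschitz operator. For any step size $\eta\in(0,\frac1L)$ and any $z_k\in\mathcal{Z}$, the extragradient update $z_{k+\frac12}=\Pi_{\mathcal{Z}}[z_k-\eta F(z_k)]$, $z_{k+1}=\Pi_{\mathcal{Z}}[z_k-\eta F(z_{k+\frac12})]$ satisfies $$r^{tan}_{(F,\mathcal{Z})}(z_k)\ge r^{tan}_{(F,\mathcal{Z})}(z_{k+1}).$$
   Context: $\|\cdot\|$ is the Euclidean norm and $\langle\cdot,\cdot\rangle$ the Euclidean inner product; $\Pi_C$ denotes Euclidean projection onto a closed convex set $C$. $F$ is monotone if $\langle F(z)-F(z'),z-z'\rangle\ge0$ for all $z,z'\in\mathcal{Z}$, and $L$-Lipschitz if $\|F(z)-F(z')\|\le L\|z-z'\|$ for all $z,z'\in\mathcal{Z}$ ($L>0$). Tangent residual: let $N_{\mathcal{Z}}(z)=\{v\in\mathbb{R}^n:\langle v,z'-z\rangle\le0\ \forall z'\in\mathcal{Z}\}$ be the normal cone, $T_{\mathcal{Z}}(z)=\{z'\in\mathbb{R}^n:\langle z',a\rangle\le0\ \forall a\in N_{\mathcal{Z}}(z)\}$ the tangent cone, and $J_{\mathcal{Z}}(z)=\{z\}+T_{\mathcal{Z}}(z)$. Then $r^{tan}_{(F,\mathcal{Z})}(z)=\|\Pi_{J_{\mathcal{Z}}(z)}[z-F(z)]-z\|$. *)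

theory Defs
  imports "HOL-Analysis.Analysis"
begin

definition monotone_operator_on :: "'a::real_inner set \<Rightarrow> ('a \<Rightarrow> 'a) \<Rightarrow> bool" where
  "monotone_operator_on Z F \<longleftrightarrow> (\<forall>z\<in>Z. \<forall>z'\<in>Z. (F z - F z') \<bullet> (z - z') \<ge> 0)"

definition normal_cone :: "'a::real_inner set \<Rightarrow> 'a \<Rightarrow> 'a set" where
  "normal_cone Z z = {v. \<forall>z'\<in>Z. v \<bullet> (z' - z) \<le> 0}"

definition tangent_cone :: "'a::real_inner set \<Rightarrow> 'a \<Rightarrow> 'a set" where
  "tangent_cone Z z = {z'. \<forall>a\<in>normal_cone Z z. z' \<bullet> a \<le> 0}"

definition tangent_set :: "'a::real_inner set \<Rightarrow> 'a \<Rightarrow> 'a set" where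
  "tangent_set Z z = (\<lambda>t. z + t) ` tangent_cone Z z"

(* closest_point C is the Euclidean projection onto C when C is closed, convex and nonempty;
   tangent_set Z z always is, as a translate of an intersection of closed half-spaces
   through the origin. *)
definition tangent_residual :: "('a::euclidean_space \<Rightarrow> 'a) \<Rightarrow> 'a set \<Rightarrow> 'a \<Rightarrow> real" where
  "tangent_residual F Z z = norm (closest_point (tangent_set Z z) (z - F z) - z)"

end

theory Submission
  imports Defs
begin

text \<open>
  The tangent residual at \<open>z\<close> is the least norm of \<open>F z + a\<close> over normal vectors \<open>a\<close> at \<open>z\<close>, by
  the decomposition of \<open>- F z\<close> into its projection on the tangent cone and a normal vector
  (\<open>tangent_residual_attained\<close>, \<open>tangent_residual_le\<close>). Let \<open>a\<close> be a minimiser at \<open>z_k\<close>. The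
  update that produces \<open>z_next\<close> supplies a particular normal vector there, namely
  \<open>c = (z_k - z_next) / \<eta> - F z_half\<close>, so it suffices to show that
  \<open>norm (F z_next + c) \<le> norm (F z_k + a)\<close>.

  After absorbing \<open>\<eta>\<close> into \<open>F\<close>, which becomes nonexpansive, this is
  \<open>extragradient_residual_decrease\<close>. Write \<open>u\<close>, \<open>v\<close>, \<open>w\<close> for the three points and
  \<open>b = u - v - F u\<close>, which is normal at \<open>v\<close>. Expanding \<open>norm (F w - F v) \<le> norm (w - v)\<close> and using
  monotonicity between \<open>u\<close> and \<open>w\<close> leaves an error term made up of \<open>inner a (u - v)\<close>,
  \<open>inner b (v - w)\<close>, \<open>inner c (w - u)\<close> and a square, all of them nonnegative. The three inner
  products run once around the triangle \<open>u\<close>, \<open>v\<close>, \<open>w\<close>: the argument rests on the cyclic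
  monotonicity of the normal cone.
\<close>

section \<open>Normal vectors\<close>

lemma normal_coneD: "v \<in> normal_cone Z z \<Longrightarrow> z' \<in> Z \<Longrightarrow> v \<bullet> (z' - z) \<le> 0"
  by (simp add: normal_cone_def)

lemma normal_cone_scaleR:
  assumes "v \<in> normal_cone Z z" and "r \<ge> 0"
  shows "r *\<^sub>R v \<in> normal_cone Z z"
  using assms by (simp add: normal_cone_def mult_nonneg_nonpos)

lemma closest_point_residual_in_normal_cone:
  fixes Z :: "'a::euclidean_space set"
  assumes "closed Z" and "convex Z"
  shows "x - closest_point Z x \<in> normal_cone Z (closest_point Z x)"
  using closest_point_dot[OF assms(2,1)] by (simp add: normal_cone_def)

section \<open>The tangent residual as a distance to the normal cone\<close>

lemma tangent_set_iff: "x \<in> tangent_set Z z \<longleftrightarrow> (\<forall>a\<in>normal_cone Z z. a \<bullet> x \<le> a \<bullet> z)"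
proof -
  have "x \<in> tangent_set Z z \<longleftrightarrow> x - z \<in> tangent_cone Z z"
    unfolding tangent_set_def by (auto intro!: image_eqI[where x = "x - z"])
  then show ?thesis
    by (simp add: tangent_cone_def inner_commute inner_diff_right)
qed

lemma closed_tangent_set: "closed (tangent_set Z z)"
  and convex_tangent_set: "convex (tangent_set Z z)"
proof -
  have "tangent_set Z z = (\<Inter>a\<in>normal_cone Z z. {x. a \<bullet> x \<le> a \<bullet> z})"
    by (auto simp: tangent_set_iff)
  then show "closed (tangent_set Z z)" "convex (tangent_set Z z)"
    by (auto intro!: closed_INT closed_halfspace_le convex_INT convex_halfspace_le)
qed

lemma base_in_tangent_set: "z \<in> tangent_set Z z"
  by (simp add: tangent_set_iff)

lemma closest_point_in_tangent_set:
  fixes Z :: "'a::euclidean_space set"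
  shows "closest_point (tangent_set Z z) x \<in> tangent_set Z z"
  using closed_tangent_set base_in_tangent_set by (metis closest_point_in_set empty_iff)

lemma tangent_residual_attained:
  fixes Z :: "'a::euclidean_space set"
  obtains a where "a \<in> normal_cone Z z" and "tangent_residual F Z z = norm (F z + a)"
proof -
  define p where "p = closest_point (tangent_set Z z) (z - F z)"
  have p: "p \<in> tangent_set Z z"
    unfolding p_def by (rule closest_point_in_tangent_set)
  have "(z - F z) - p \<in> normal_cone Z z"
    unfolding normal_cone_def
  proof (intro CollectI ballI)
    fix z' assume "z' \<in> Z"
    \<comment> \<open>The tangent cone is closed under adding the feasible direction \<open>z' - z\<close>.\<close>
    have "p + (z' - z) \<in> tangent_set Z z"
      unfolding tangent_set_iff
    proof
      fix a assume "a \<in> normal_cone Z z"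
      then show "a \<bullet> (p + (z' - z)) \<le> a \<bullet> z"
        using p normal_coneD[OF _ \<open>z' \<in> Z\<close>, of a z]
        by (fastforce simp: tangent_set_iff inner_add_right)
    qed
    from closest_point_dot[OF convex_tangent_set closed_tangent_set this, of "z - F z"]
    show "((z - F z) - p) \<bullet> (z' - z) \<le> 0"
      by (simp add: p_def)
  qed
  moreover have "tangent_residual F Z z = norm (F z + ((z - F z) - p))"
    by (simp add: tangent_residual_def p_def norm_minus_commute)
  ultimately show thesis
    by (rule that)
qed

lemma tangent_residual_le:
  fixes Z :: "'a::euclidean_space set"
  assumes "c \<in> normal_cone Z z"
  shows "tangent_residual F Z z \<le> norm (F z + c)"
proof -
  define p where "p = closest_point (tangent_set Z z) (z - F z)"
  define t where "t = p - z"
  have "p \<in> tangent_set Z z"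
    unfolding p_def by (rule closest_point_in_tangent_set)
  with assms have ct: "c \<bullet> t \<le> 0"
    by (auto simp: tangent_set_iff t_def inner_diff_right)
  have "((z - F z) - p) \<bullet> (z - p) \<le> 0"
    unfolding p_def
    by (rule closest_point_dot[OF convex_tangent_set closed_tangent_set base_in_tangent_set])
  then have "t \<bullet> t \<le> - (F z) \<bullet> t"
    by (simp add: t_def algebra_simps inner_commute)
  also have "\<dots> \<le> - (F z + c) \<bullet> t"
    using ct by (simp add: inner_diff_left)
  also have "\<dots> \<le> norm (F z + c) * norm t"
    using norm_cauchy_schwarz[of "- (F z + c)" t] by (metis norm_minus_cancel)
  finally have "norm t * norm t \<le> norm (F z + c) * norm t"
    by (simp add: dot_square_norm power2_eq_square)
  then have "norm t \<le> norm (F z + c)"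
    by (cases "t = 0") auto
  then show ?thesis
    by (simp add: tangent_residual_def t_def p_def)
qed

section \<open>One extragradient step\<close>

text \<open>
  The step with step size absorbed: \<open>fu\<close>, \<open>fv\<close>, \<open>fw\<close> are the values of the scaled operator at the
  current, the intermediate and the next point, and \<open>a\<close>, \<open>b\<close>, \<open>c\<close> are normal vectors there.
\<close>
lemma extragradient_residual_decrease:
  fixes u v w :: "'a::real_inner"
  assumes v: "v = u - (fu + b)" and w: "w = u - (fv + c)"
    and Z: "u \<in> Z" "v \<in> Z" "w \<in> Z"
    and a: "a \<in> normal_cone Z u" and b: "b \<in> normal_cone Z v" and c: "c \<in> normal_cone Z w"
    and mono: "(fw - fu) \<bullet> (w - u) \<ge> 0"
    and lip: "norm (fw - fv) \<le> norm (w - v)"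
  shows "norm (fw + c) \<le> norm (fu + a)"
proof -
  have cyc: "a \<bullet> (v - u) \<le> 0" "b \<bullet> (w - v) \<le> 0" "c \<bullet> (u - w) \<le> 0"
    using a b c Z by (auto intro: normal_coneD)
  have lip': "(fw - fv) \<bullet> (fw - fv) \<le> (w - v) \<bullet> (w - v)"
    using lip by (simp add: norm_le)
  have sq: "(a - b) \<bullet> (a - b) \<ge> 0"
    by simp
  have "(fu + a) \<bullet> (fu + a) - (fw + c) \<bullet> (fw + c) =
      ((w - v) \<bullet> (w - v) - (fw - fv) \<bullet> (fw - fv)) + 2 * ((fw - fu) \<bullet> (w - u))
      + (a - b) \<bullet> (a - b) - 2 * (a \<bullet> (v - u) + b \<bullet> (w - v) + c \<bullet> (u - w))"
    unfolding v w by (simp add: inner_add_left inner_add_right inner_diff_left inner_diff_right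
        inner_commute algebra_simps)
  then have "(fw + c) \<bullet> (fw + c) \<le> (fu + a) \<bullet> (fu + a)"
    using cyc lip' sq mono by (smt (verit))
  then show ?thesis
    by (simp add: norm_le)
qed

theorem theorem2:
  fixes Z :: "(real ^ 'n) set"
    and F :: "real ^ 'n \<Rightarrow> real ^ 'n"
    and L \<eta> :: real
    and z_k z_half z_next :: "real ^ 'n"
  assumes "closed Z" and "convex Z"
    and "monotone_operator_on Z F"
    and "L > 0" and "L-lipschitz_on Z F"
    and "\<eta> \<in> {0<..<1 / L}"
    and "z_k \<in> Z"
    and "z_half = closest_point Z (z_k - \<eta> *\<^sub>R F z_k)"
    and "z_next = closest_point Z (z_k - \<eta> *\<^sub>R F z_half)"
  shows "tangent_residual F Z z_k \<ge> tangent_residual F Z z_next"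
proof -
  have \<eta>: "\<eta> > 0" "\<eta> * L \<le> 1"
    using assms(4,6) by (auto simp: field_simps)
  have Z: "z_half \<in> Z" "z_next \<in> Z"
    using assms(1,7,8,9) by (auto intro: closest_point_in_set)
  obtain a where a: "a \<in> normal_cone Z z_k" "tangent_residual F Z z_k = norm (F z_k + a)"
    by (rule tangent_residual_attained)
  define b where "b = (z_k - \<eta> *\<^sub>R F z_k) - z_half"
  define c where "c = (z_k - \<eta> *\<^sub>R F z_half) - z_next"
  have b: "b \<in> normal_cone Z z_half" and c: "c \<in> normal_cone Z z_next"
    unfolding b_def c_def assms(8) assms(9)
    by (rule closest_point_residual_in_normal_cone[OF assms(1,2)])+
  have mono: "(\<eta> *\<^sub>R F z_next - \<eta> *\<^sub>R F z_k) \<bullet> (z_next - z_k) \<ge> 0"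
    using assms(3,7) Z \<eta>
    by (simp add: monotone_operator_on_def flip: scaleR_diff_right)
  have "norm (\<eta> *\<^sub>R F z_next - \<eta> *\<^sub>R F z_half) = \<eta> * norm (F z_next - F z_half)"
    using \<eta> by (simp flip: scaleR_diff_right)
  also have "\<dots> \<le> \<eta> * (L * norm (z_next - z_half))"
    using lipschitz_onD[OF assms(5) Z(2,1)] \<eta> by (simp add: dist_norm)
  also have "\<dots> \<le> norm (z_next - z_half)"
    using mult_right_mono[OF \<eta>(2), of "norm (z_next - z_half)"] by (simp add: mult.assoc)
  finally have lip: "norm (\<eta> *\<^sub>R F z_next - \<eta> *\<^sub>R F z_half) \<le> norm (z_next - z_half)" .
  have "norm (\<eta> *\<^sub>R F z_next + c) \<le> norm (\<eta> *\<^sub>R F z_k + \<eta> *\<^sub>R a)"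
  proof (rule extragradient_residual_decrease[OF _ _ assms(7) Z _ b c mono lip])
    show "z_half = z_k - (\<eta> *\<^sub>R F z_k + b)" "z_next = z_k - (\<eta> *\<^sub>R F z_half + c)"
      by (simp_all add: b_def c_def)
    show "\<eta> *\<^sub>R a \<in> normal_cone Z z_k"
      using a(1) \<eta> by (simp add: normal_cone_scaleR)
  qed
  moreover have "\<eta> *\<^sub>R F z_next + c = \<eta> *\<^sub>R (F z_next + (1 / \<eta>) *\<^sub>R c)"
    using \<eta> by (simp add: scaleR_add_right)
  ultimately have "\<eta> * norm (F z_next + (1 / \<eta>) *\<^sub>R c) \<le> \<eta> * norm (F z_k + a)"
    using \<eta> by (simp flip: scaleR_add_right)
  then have "norm (F z_next + (1 / \<eta>) *\<^sub>R c) \<le> norm (F z_k + a)"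
    using \<eta> by simp
  moreover have "tangent_residual F Z z_next \<le> norm (F z_next + (1 / \<eta>) *\<^sub>R c)"
    using c \<eta> by (intro tangent_residual_le normal_cone_scaleR) auto
  ultimately show ?thesis
    using a(2) by simp
qed

end
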